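(* Let $\mathfrak k$ be a field, $n\ge2$, and let $\Lambda=\mathfrak kF$ be the group algebra of the free group $F$ on $t_1,\dots,t_n$ with Fox algebra $L(\Lambda)$. For any two elements (free polynomials) $\gamma,\lambda\in\Lambda$ there is a uniquely determined comonic polynomial $\delta\in\Lambda$ of length at most $m=\min\{|\gamma|,|\lambda|\}$, called the greatest common divisor of $\gamma,\lambda$, with the property that $\delta$ is a generator (uniquely determined up to a unit) of the left ideal of $L(\Lambda)$ generated by $\gamma$ and $\lambda$, that is, $L(\Lambda)\gamma+L(\Lambda)\lambda=L(\Lambda)\delta$.
   Context: Elements of $\Lambda$ are called free polynomials. Let $\varepsilon\colon\Lambda\to\mathfrak k$ be the augmentation ($t_i\mapsto1$); $\gamma\in\Lambda$ is comonic if $\varepsilon(\gamma)=1$. The length $|\gamma|$ of $\gamma\in\Lambda$ is the maximum of the lengths of the reduced words $w\in F$ occurring in $\gamma$ with nonzero coefficient ($|1|=0$). Put $x_i=t_i-1$. The Fox algebra $L(\Lambda)$ is the Leavitt localization of $\Lambda$ inverting universally the row $(x_1,\dots,x_n)$, i.e. the $\mathfrak k$-algebra generated over $\Lambda$ by $x_1^*,\dots,x_n^*$ subject to $x_i^*x_j=\delta_{ij}$ (Kronecker symbol) and $\sum_{i=1}^nx_ix_i^*=1$; it contains $\Lambda$.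
   Formalization: The case γ = λ = 0, where no comonic generator exists, is excluded; if exactly one is 0, m is the length of the other; and δ is unique among comonic generators only up to a unit of Λ, since for γ = λ = t₁ both 1 and t₁ qualify. *)

theory Defs
  imports Complex_Main "HOL-Library.Cardinality" "HOL-Library.Poly_Mapping"
begin

section \<open>The free group\<close>

text \<open>The letter \<open>(i, True)\<close> stands for \<open>t\<^sub>i\<close> and \<open>(i, False)\<close> for its inverse.\<close>

definition letter_inv :: "'n \<times> bool \<Rightarrow> 'n \<times> bool" where
  "letter_inv a = (fst a, \<not> snd a)"

definition reduced :: "('n \<times> bool) list \<Rightarrow> bool" where
  "reduced = successively (\<lambda>a b. b \<noteq> letter_inv a)"

fun cons_red :: "'n \<times> bool \<Rightarrow> ('n \<times> bool) list \<Rightarrow> ('n \<times> bool) list" where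
  "cons_red a [] = [a]"
| "cons_red a (b # w) = (if b = letter_inv a then w else a # b # w)"

lemma letter_inv_letter_inv [simp]: "letter_inv (letter_inv a) = a"
  by (simp add: letter_inv_def)

lemma letter_inv_eq_iff [simp]: "letter_inv a = letter_inv b \<longleftrightarrow> a = b"
  by (metis letter_inv_letter_inv)

lemma reduced_Nil [simp]: "reduced []"
  by (simp add: reduced_def)

lemma reduced_Cons:
  "reduced (a # w) \<longleftrightarrow> w = [] \<or> hd w \<noteq> letter_inv a \<and> reduced w"
  by (auto simp: reduced_def successively_Cons)

lemma reduced_tl: "reduced (a # w) \<Longrightarrow> reduced w"
  by (auto simp: reduced_Cons)

lemma reduced_cons_red: "reduced w \<Longrightarrow> reduced (cons_red a w)"
  by (cases w) (auto simp: reduced_Cons)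

lemma cons_red_reduced: "reduced (a # w) \<Longrightarrow> cons_red a w = a # w"
  by (cases w) (auto simp: reduced_Cons)

lemma cons_red_cancel: "reduced w \<Longrightarrow> cons_red a (cons_red (letter_inv a) w) = w"
  by (cases w) (auto simp: cons_red_reduced)

lemma reduced_foldr: "reduced v \<Longrightarrow> reduced (foldr cons_red w v)"
  by (induction w) (auto simp: reduced_cons_red)

lemma foldr_cons_red_Nil: "reduced w \<Longrightarrow> foldr cons_red w [] = w"
proof (induction w)
  case (Cons a w)
  then show ?case
    using cons_red_reduced[OF Cons.prems] reduced_tl[OF Cons.prems] by simp
qed simp

lemma foldr_cons_red_step:
  "reduced v \<Longrightarrow> foldr cons_red (cons_red a w) v = cons_red a (foldr cons_red w v)"
  by (cases w) (auto simp: cons_red_cancel reduced_foldr)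

lemma foldr_cons_red_assoc:
  "reduced u \<Longrightarrow>
     foldr cons_red (foldr cons_red w v) u = foldr cons_red w (foldr cons_red v u)"
  by (induction w) (auto simp: foldr_cons_red_step)

lemma foldr_cons_red_inv: "foldr cons_red (rev (map letter_inv w)) w = []"
  by (induction w) auto

lemma reduced_inv: "reduced w \<Longrightarrow> reduced (rev (map letter_inv w))"
  by (auto simp: reduced_def successively_map intro: successively_mono)

typedef 'n free_group = "{w :: ('n \<times> bool) list. reduced w}"
  morphisms word_of Abs_free_group
  by (rule exI[of _ "[]"]) simp

setup_lifting type_definition_free_group

text \<open>The group is written additively, although it is not commutative, because the
  convolution product of \<^typ>\<open>'a \<Rightarrow>\<^sub>0 'b\<close> is built on the class \<^class>\<open>monoid_add\<close>.\<close>

instantiation free_group :: (type) group_add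
begin

lift_definition zero_free_group :: "'n free_group" is "[]" by simp

lift_definition plus_free_group :: "'n free_group \<Rightarrow> 'n free_group \<Rightarrow> 'n free_group"
  is "\<lambda>v w. foldr cons_red v w" by (rule reduced_foldr)

lift_definition uminus_free_group :: "'n free_group \<Rightarrow> 'n free_group"
  is "\<lambda>w. rev (map letter_inv w)" by (rule reduced_inv)

definition minus_free_group :: "'n free_group \<Rightarrow> 'n free_group \<Rightarrow> 'n free_group" where
  "minus_free_group v w = v + - w"

instance
proof
  fix a b c :: "'n free_group"
  show "a + b + c = a + (b + c)" by transfer (rule foldr_cons_red_assoc)
  show "0 + a = a" by transfer simp
  show "a + 0 = a" by transfer (rule foldr_cons_red_Nil)
  show "- a + a = 0" by transfer (rule foldr_cons_red_inv)
  show "a + - b = a - b" by (simp add: minus_free_group_def)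
qed

end

lift_definition gen :: "'n \<Rightarrow> 'n free_group" is "\<lambda>i. [(i, True)]"
  by (simp add: reduced_def)

section \<open>Free polynomials\<close>

type_synonym ('n, 'k) free_poly = "'n free_group \<Rightarrow>\<^sub>0 'k"

definition scalar :: "'k \<Rightarrow> ('n, 'k::field) free_poly" where
  "scalar c = Poly_Mapping.single 0 c"

definition var_t :: "'n \<Rightarrow> ('n, 'k::field) free_poly" where
  "var_t i = Poly_Mapping.single (gen i) 1"

definition var_x :: "'n \<Rightarrow> ('n, 'k::field) free_poly" where
  "var_x i = var_t i - 1"

text \<open>The augmentation sends every group element to 1, so it adds up the coefficients.\<close>

definition augmentation :: "('n, 'k::field) free_poly \<Rightarrow> 'k" where
  "augmentation \<gamma> = (\<Sum>g\<in>Poly_Mapping.keys \<gamma>. Poly_Mapping.lookup \<gamma> g)"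

definition comonic :: "('n, 'k::field) free_poly \<Rightarrow> bool" where
  "comonic \<gamma> \<longleftrightarrow> augmentation \<gamma> = 1"

text \<open>Only meaningful for nonzero arguments: the maximum of the empty set is unspecified.\<close>

definition poly_length :: "('n, 'k::field) free_poly \<Rightarrow> nat" where
  "poly_length \<gamma> = Max ((\<lambda>g. length (word_of g)) ` Poly_Mapping.keys \<gamma>)"

section \<open>The Fox algebra\<close>

text \<open>The algebra is presented directly: formal ring expressions in elements of the group
  algebra and symbols \<open>x\<^sub>i\<^sup>*\<close>, modulo the least congruence that contains the ring axioms, the
  operations of the group algebra, centrality of the scalars, and the defining relations.
  The zero and the one are those of the group algebra.\<close>

declare [[typedef_overloaded]]

datatype ('n, 'k) fox_term =
    Emb "('n, 'k::field) free_poly"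
  | Star 'n
  | Add "('n, 'k) fox_term" "('n, 'k) fox_term"
  | Neg "('n, 'k) fox_term"
  | Mul "('n, 'k) fox_term" "('n, 'k) fox_term"

inductive fox_cong :: "('n::finite, 'k::field) fox_term \<Rightarrow> ('n, 'k) fox_term \<Rightarrow> bool" where
  fc_refl: "fox_cong a a"
| fc_sym: "fox_cong a b \<Longrightarrow> fox_cong b a"
| fc_trans: "fox_cong a b \<Longrightarrow> fox_cong b c \<Longrightarrow> fox_cong a c"
| fc_Add: "fox_cong a a' \<Longrightarrow> fox_cong b b' \<Longrightarrow> fox_cong (Add a b) (Add a' b')"
| fc_Neg: "fox_cong a a' \<Longrightarrow> fox_cong (Neg a) (Neg a')"
| fc_Mul: "fox_cong a a' \<Longrightarrow> fox_cong b b' \<Longrightarrow> fox_cong (Mul a b) (Mul a' b')"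
| fc_add_assoc: "fox_cong (Add (Add a b) c) (Add a (Add b c))"
| fc_add_commute: "fox_cong (Add a b) (Add b a)"
| fc_add_zero: "fox_cong (Add (Emb 0) a) a"
| fc_add_neg: "fox_cong (Add (Neg a) a) (Emb 0)"
| fc_mul_assoc: "fox_cong (Mul (Mul a b) c) (Mul a (Mul b c))"
| fc_mul_one_left: "fox_cong (Mul (Emb 1) a) a"
| fc_mul_one_right: "fox_cong (Mul a (Emb 1)) a"
| fc_distrib_left: "fox_cong (Mul a (Add b c)) (Add (Mul a b) (Mul a c))"
| fc_distrib_right: "fox_cong (Mul (Add a b) c) (Add (Mul a c) (Mul b c))"
| fc_emb_add: "fox_cong (Emb (\<gamma> + \<mu>)) (Add (Emb \<gamma>) (Emb \<mu>))"
| fc_emb_mul: "fox_cong (Emb (\<gamma> * \<mu>)) (Mul (Emb \<gamma>) (Emb \<mu>))"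
| fc_scalar: "fox_cong (Mul (Emb (scalar c)) (Star i)) (Mul (Star i) (Emb (scalar c)))"
| fc_star_x: "fox_cong (Mul (Star i) (Emb (var_x j))) (Emb (if i = j then 1 else 0))"
| fc_x_star:
    \<comment> \<open>Expressions have no finite sums yet, so the sum of the \<open>x\<^sub>i x\<^sub>i\<^sup>*\<close> is written along an
      arbitrary enumeration of the index type; see \<open>sum_x_star\<close> below.\<close>
    "distinct ns \<Longrightarrow> set ns = UNIV \<Longrightarrow>
       fox_cong (foldr (\<lambda>i a. Add (Mul (Emb (var_x i)) (Star i)) a) ns (Emb 0)) (Emb 1)"

quotient_type (overloaded) ('n, 'k) fox_algebra =
    "('n::finite, 'k::field) fox_term" / fox_cong
  by (intro equivpI reflpI sympI transpI) (blast intro: fc_refl fc_sym fc_trans)+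

instantiation fox_algebra :: (finite, field) "{ring, monoid_mult}"
begin

lift_definition zero_fox_algebra :: "('n::finite, 'k::field) fox_algebra" is "Emb 0" .
lift_definition one_fox_algebra :: "('n::finite, 'k::field) fox_algebra" is "Emb 1" .

lift_definition plus_fox_algebra ::
  "('n::finite, 'k::field) fox_algebra \<Rightarrow> ('n, 'k) fox_algebra \<Rightarrow> ('n, 'k) fox_algebra"
  is Add by (rule fc_Add)

lift_definition uminus_fox_algebra ::
  "('n::finite, 'k::field) fox_algebra \<Rightarrow> ('n, 'k) fox_algebra"
  is Neg by (rule fc_Neg)

lift_definition times_fox_algebra ::
  "('n::finite, 'k::field) fox_algebra \<Rightarrow> ('n, 'k) fox_algebra \<Rightarrow> ('n, 'k) fox_algebra"
  is Mul by (rule fc_Mul)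

definition minus_fox_algebra ::
  "('n::finite, 'k::field) fox_algebra \<Rightarrow> ('n, 'k) fox_algebra \<Rightarrow> ('n, 'k) fox_algebra"
  where "minus_fox_algebra a b = a + - b"

instance
proof
  fix a b c :: "('n::finite, 'k::field) fox_algebra"
  show "a + b + c = a + (b + c)" by transfer (rule fc_add_assoc)
  show "a + b = b + a" by transfer (rule fc_add_commute)
  show "0 + a = a" by transfer (rule fc_add_zero)
  show "- a + a = 0" by transfer (rule fc_add_neg)
  show "a - b = a + - b" by (rule minus_fox_algebra_def)
  show "a * b * c = a * (b * c)" by transfer (rule fc_mul_assoc)
  show "1 * a = a" by transfer (rule fc_mul_one_left)
  show "a * 1 = a" by transfer (rule fc_mul_one_right)
  show "a * (b + c) = a * b + a * c" by transfer (rule fc_distrib_left)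
  show "(a + b) * c = a * c + b * c" by transfer (rule fc_distrib_right)
qed

end

lift_definition emb :: "('n::finite, 'k::field) free_poly \<Rightarrow> ('n, 'k) fox_algebra" is Emb .

lift_definition star :: "'n::finite \<Rightarrow> ('n, 'k::field) fox_algebra" is Star .

lemma emb_0: "emb 0 = 0"
  by (simp add: emb_def zero_fox_algebra_def)

lemma emb_1: "emb 1 = 1"
  by (simp add: emb_def one_fox_algebra_def)

lemma emb_add: "emb (\<gamma> + \<mu>) = emb \<gamma> + emb \<mu>"
  by transfer (rule fc_emb_add)

lemma emb_mult: "emb (\<gamma> * \<mu>) = emb \<gamma> * emb \<mu>"
  by transfer (rule fc_emb_mul)

lemma scalar_star: "emb (scalar c) * star i = star i * emb (scalar c)"
  by transfer (rule fc_scalar)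

lemma star_x:
  "star i * emb (var_x j) = (if i = j then 1 else (0 :: ('n::finite, 'k::field) fox_algebra))"
proof -
  have "star i * emb (var_x j) = (emb (if i = j then 1 else 0) :: ('n, 'k) fox_algebra)"
    by transfer (rule fc_star_x)
  then show ?thesis by (simp add: emb_0 emb_1)
qed

lemma sum_x_star:
  "(\<Sum>i\<in>UNIV. emb (var_x i) * star i) = (1 :: ('n::finite, 'k::field) fox_algebra)"
proof -
  obtain ns :: "'n list" where ns: "distinct ns" "set ns = UNIV"
    using finite_distinct_list[OF finite_class.finite_UNIV] by blast
  have abs: "abs_fox_algebra (foldr (\<lambda>i a. Add (Mul (Emb (var_x i)) (Star i)) a) ms (Emb 0))
      = sum_list (map (\<lambda>i. emb (var_x i) * star i :: ('n, 'k) fox_algebra) ms)" for ms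
    by (induction ms)
       (simp_all add: zero_fox_algebra_def plus_fox_algebra.abs_eq[symmetric]
          times_fox_algebra.abs_eq[symmetric] emb.abs_eq[symmetric] star.abs_eq[symmetric])
  have "(\<Sum>i\<in>UNIV. emb (var_x i) * star i :: ('n, 'k) fox_algebra)
      = sum_list (map (\<lambda>i. emb (var_x i) * star i) ns)"
    using ns by (simp add: sum_list_distinct_conv_sum_set)
  also have "\<dots> = abs_fox_algebra (Emb 1)"
    unfolding abs[symmetric] fox_algebra.abs_eq_iff using ns by (rule fc_x_star)
  finally show ?thesis by (simp add: one_fox_algebra_def)
qed

definition left_ideal1 :: "'a::ring \<Rightarrow> 'a set" where
  "left_ideal1 a = {r * a |r. True}"

definition left_ideal2 :: "'a::ring \<Rightarrow> 'a \<Rightarrow> 'a set" where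
  "left_ideal2 a b = {r * a + s * b |r s. True}"

text \<open>The library's predicate for units requires commutative multiplication.\<close>

definition ring_unit :: "'a::monoid_mult \<Rightarrow> bool" where
  "ring_unit u \<longleftrightarrow> (\<exists>v. u * v = 1 \<and> v * u = 1)"

end

theory Submission
  imports Defs
begin

text \<open>The elements of \<open>\<Lambda>\<close> lying in the left ideal \<open>L\<gamma> + L\<mu>\<close> form a left ideal \<open>K\<close> of \<open>\<Lambda>\<close> which
  contains the Fox derivatives \<open>\<partial>\<^sub>i f = x\<^sub>i\<^sup>* f\<close> of each of its elements \<open>f\<close> of augmentation 0.
  A derivative \<open>\<partial>\<^sub>i f\<close> is not longer than \<open>f\<close>, and its words of the length of \<open>f\<close> are the words
  of \<open>f\<close> that begin with \<open>t\<^sub>i\<inverse>\<close>, with negated coefficients; so \<open>\<partial>\<^sub>i f + \<partial>\<^sub>i (\<partial>\<^sub>i f)\<close> is shorter.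
  This kind of cancellation shows that \<open>K\<close> contains a comonic \<open>\<delta>\<close> of minimal length with
  \<open>K = \<Lambda>\<delta>\<close>: two elements of minimal length and augmentation 0 are proportional and have
  the form \<open>c x\<^sub>i \<delta>\<close>, and longer elements are reduced by induction on the length.

  For uniqueness, \<open>\<Lambda>/\<Lambda>\<delta>'\<close> is an \<open>L\<close>-module for every comonic \<open>\<delta>'\<close>, whence
  \<open>L\<delta>' \<inter> \<Lambda> = \<Lambda>\<delta>'\<close>. Two comonic generators of the same left ideal of \<open>L\<close> thus generate the
  same left ideal of \<open>\<Lambda>\<close>, and comonic elements are not right zero divisors.\<close>

section \<open>Scalars, coefficients and augmentation of free polynomials\<close>

abbreviation monom :: "'n free_group \<Rightarrow> ('n, 'k::field) free_poly" where
  "monom g \<equiv> Poly_Mapping.single g 1"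

text \<open>Reduces identities between additive maps to single terms, with no side condition on keys
  in the \<open>sum\<close> step.\<close>

lemma poly_mapping_induct [case_names single sum]:
  fixes f :: "'a \<Rightarrow>\<^sub>0 'b::comm_monoid_add"
  assumes "\<And>k v. P (Poly_Mapping.single k v)"
    and "\<And>f g. P f \<Longrightarrow> P g \<Longrightarrow> P (f + g)"
  shows "P f"
proof (induction f rule: update_induct)
  case const
  show ?case using assms(1)[of undefined 0] by simp
next
  case (update f a b)
  have "Poly_Mapping.update a b f = f + Poly_Mapping.single a b"
    using update(1)
    by (intro poly_mapping_eqI) (auto simp: lookup_update lookup_add lookup_single in_keys_iff)
  then show ?case using assms(2)[OF update(3) assms(1)] by simp
qed

lemma scalar_mult_single: "scalar c * Poly_Mapping.single g d = Poly_Mapping.single g (c * d)"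
  by (simp add: scalar_def mult_single)

lemma scalar_commute: "scalar c * f = f * scalar c"
  by (induction f rule: poly_mapping_induct)
     (simp_all add: scalar_def mult_single mult.commute algebra_simps)

lemma scalar_1 [simp]: "scalar 1 = 1"
  by (simp add: scalar_def)

lemma scalar_0 [simp]: "scalar 0 = 0"
  by (simp add: scalar_def)

lemma scalar_uminus: "scalar (- c) = - scalar c"
  by (simp add: scalar_def single_uminus)

lemma lookup_scalar_mult: "Poly_Mapping.lookup (scalar c * f) g = c * Poly_Mapping.lookup f g"
  by (induction f rule: poly_mapping_induct)
     (simp_all add: scalar_mult_single lookup_single when_def lookup_add algebra_simps)

lemma lookup_monom_mult: "Poly_Mapping.lookup (monom g * f) h = Poly_Mapping.lookup f (- g + h)"
proof (induction f rule: poly_mapping_induct)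
  case (single k v)
  have "g + k = h \<longleftrightarrow> k = - g + h"
    by (metis add.assoc add_0 left_minus right_minus)
  then show ?case by (simp add: mult_single lookup_single when_def)
qed (simp add: algebra_simps lookup_add)

lemma augmentation_superset:
  assumes "finite S" "Poly_Mapping.keys f \<subseteq> S"
  shows "augmentation f = (\<Sum>g\<in>S. Poly_Mapping.lookup f g)"
  unfolding augmentation_def
  by (rule sum.mono_neutral_left) (use assms in \<open>auto simp: in_keys_iff\<close>)

lemma augmentation_add: "augmentation (f + g) = augmentation f + augmentation g"
proof -
  let ?S = "Poly_Mapping.keys f \<union> Poly_Mapping.keys g"
  show ?thesis
    using augmentation_superset[of ?S f] augmentation_superset[of ?S g]
      augmentation_superset[of ?S "f + g"] Poly_Mapping.keys_add[of f g]
    by (simp add: lookup_add sum.distrib)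
qed

lemma augmentation_single [simp]: "augmentation (Poly_Mapping.single g c) = c"
  by (simp add: augmentation_def)

lemma augmentation_0 [simp]: "augmentation 0 = 0"
  by (simp add: augmentation_def)

lemma augmentation_1 [simp]: "augmentation 1 = 1"
  by (metis augmentation_single single_one)

lemma augmentation_uminus: "augmentation (- f) = - augmentation f"
  by (metis augmentation_0 augmentation_add add.right_inverse minus_unique)

lemma augmentation_diff: "augmentation (f - g) = augmentation f - augmentation g"
  by (metis augmentation_add augmentation_uminus diff_conv_add_uminus)

lemma augmentation_mult: "augmentation (f * g) = augmentation f * augmentation g"
proof (induction f rule: poly_mapping_induct)
  case (single k v)
  show ?case
    by (induction g rule: poly_mapping_induct)
       (simp_all add: mult_single augmentation_add algebra_simps)
qed (simp add: augmentation_add algebra_simps)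

lemma augmentation_scalar [simp]: "augmentation (scalar c) = c"
  by (simp add: scalar_def)

lemma augmentation_var_x [simp]: "augmentation (var_x i) = 0"
  by (simp add: var_x_def var_t_def augmentation_diff)

section \<open>Fox derivatives\<close>

text \<open>The derivatives with respect to right multiples: they are defined by
  \<open>f = \<epsilon>(f) + \<Sum>\<^sub>i x\<^sub>i \<partial>\<^sub>i f\<close>, so that \<open>\<partial>\<^sub>i (t\<^sub>i w) = \<partial>\<^sub>i w + w\<close> and
  \<open>\<partial>\<^sub>i (t\<^sub>i\<inverse> w) = \<partial>\<^sub>i w - t\<^sub>i\<inverse> w\<close>.\<close>

fun fox_word :: "'n \<Rightarrow> ('n \<times> bool) list \<Rightarrow> ('n, 'k::field) free_poly" where
  "fox_word i [] = 0"
| "fox_word i (a # w) = fox_word i w +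
     (if a = (i, True) then monom (Abs_free_group w)
      else if a = (i, False) then - monom (Abs_free_group (a # w)) else 0)"

definition fox :: "'n \<Rightarrow> ('n, 'k::field) free_poly \<Rightarrow> ('n, 'k) free_poly" where
  "fox i f = (\<Sum>g\<in>Poly_Mapping.keys f. scalar (Poly_Mapping.lookup f g) * fox_word i (word_of g))"

lemma fox_superset:
  assumes "finite S" "Poly_Mapping.keys f \<subseteq> S"
  shows "fox i f = (\<Sum>g\<in>S. scalar (Poly_Mapping.lookup f g) * fox_word i (word_of g))"
  unfolding fox_def
  by (rule sum.mono_neutral_left) (use assms in \<open>auto simp: in_keys_iff\<close>)

lemma scalar_add: "scalar (c + d) = scalar c + scalar d"
  by (simp add: scalar_def single_add)

lemma scalar_diff: "scalar (c - d) = scalar c - scalar d"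
  by (simp add: scalar_def single_diff)

lemma fox_add: "fox i (f + g) = fox i f + fox i g"
proof -
  let ?S = "Poly_Mapping.keys f \<union> Poly_Mapping.keys g"
  show ?thesis
    using fox_superset[of ?S f i] fox_superset[of ?S g i]
      fox_superset[of ?S "f + g" i] Poly_Mapping.keys_add[of f g]
    by (simp add: lookup_add sum.distrib scalar_add algebra_simps)
qed

lemma fox_0 [simp]: "fox i 0 = 0"
  by (simp add: fox_def)

lemma fox_uminus: "fox i (- f) = - fox i f"
  by (metis fox_0 fox_add add.right_inverse minus_unique)

lemma fox_diff: "fox i (f - g) = fox i f - fox i g"
  by (metis fox_add fox_uminus diff_conv_add_uminus)

lemma fox_single: "fox i (Poly_Mapping.single g c) = scalar c * fox_word i (word_of g)"
  by (simp add: fox_def)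

lemma fox_scalar [simp]: "fox i (scalar c) = 0"
  unfolding scalar_def fox_single by (simp add: zero_free_group.rep_eq)

text \<open>If \<open>w\<close> starts with the inverse of the new letter, the two cancel; the term
  \<open>- monom\<close> that \<open>fox_word\<close> attached to that inverse letter is then offset
  by the added \<open>monom\<close>.\<close>

lemma fox_word_cons_red:
  assumes "reduced w"
  shows "fox_word i (cons_red (j, True) w) =
    fox_word i w + (if i = j then monom (Abs_free_group w) else (0 :: ('n, 'k::field) free_poly))"
  by (cases w) (auto simp: letter_inv_def)

lemma word_of_gen_add: "word_of (gen j + g) = cons_red (j, True) (word_of g)"
  by (simp add: plus_free_group.rep_eq gen.rep_eq)

lemma fox_var_t_mult:
  "fox i (var_t j * f) = fox i f + (if i = j then f else 0)"
proof (induction f rule: poly_mapping_induct)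
  case (single g c)
  have "reduced (word_of g)" using word_of[of g] by simp
  then show ?case
    by (simp add: var_t_def mult_single fox_single word_of_gen_add fox_word_cons_red
        word_of_inverse distrib_left scalar_mult_single)
qed (simp add: algebra_simps fox_add)

lemma fox_var_x_mult: "fox i (var_x j * f) = (if i = j then f else 0)"
  by (simp add: var_x_def left_diff_distrib fox_diff fox_var_t_mult)

lemma fox_sum: "fox i (\<Sum>x\<in>A. f x) = (\<Sum>x\<in>A. fox i (f x))"
  by (induction A rule: infinite_finite_induct) (simp_all add: fox_add)

lemma fox_var_x_sum:
  "fox i (\<Sum>j\<in>UNIV. var_x j * f j) = (f (i :: 'n::finite) :: ('n, 'k::field) free_poly)"
  by (simp add: fox_sum fox_var_x_mult)

lemma monom_decomp:
  "monom g = 1 + (\<Sum>i\<in>UNIV. var_x i * fox_word (i :: 'n::finite) (word_of g) :: ('n, 'k::field) free_poly)"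
proof -
  have "monom (Abs_free_group w) =
      1 + (\<Sum>i\<in>UNIV. var_x i * fox_word (i :: 'n::finite) w :: ('n, 'k::field) free_poly)"
    if "reduced w" for w
    using that
  proof (induction w)
    case Nil
    then show ?case by (simp add: zero_free_group_def[symmetric])
  next
    case (Cons a w)
    obtain j s where a: "a = (j, s)" by (cases a)
    have red: "reduced w" using Cons.prems by (rule reduced_tl)
    let ?w = "Abs_free_group w" and ?aw = "Abs_free_group (a # w)"
    have wo: "word_of ?w = w" "word_of ?aw = a # w"
      using red Cons.prems by (simp_all add: Abs_free_group_inverse)
    show ?case
    proof (cases s)
      case True
      have "?aw = gen j + ?w"
        by (rule word_of_inject[THEN iffD1])
           (use wo a True Cons.prems in \<open>simp add: word_of_gen_add cons_red_reduced\<close>)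
      then have "monom ?aw = monom ?w + var_x j * (monom ?w :: ('n, 'k) free_poly)"
        by (simp add: var_x_def var_t_def mult_single left_diff_distrib)
      then show ?thesis
        using Cons.IH[OF red] True
        by (simp add: a distrib_left sum.distrib if_distrib[of "\<lambda>x. _ * x"] cong: if_cong)
    next
      case False
      \<comment> \<open>For an inverse letter the shorter word arises from the longer one by
        \<open>gen j\<close>, so the recursion is solved backwards.\<close>
      have "?w = gen j + ?aw"
        by (rule word_of_inject[THEN iffD1])
           (use wo a False in \<open>simp add: word_of_gen_add letter_inv_def\<close>)
      then have "monom ?w = monom ?aw + var_x j * (monom ?aw :: ('n, 'k) free_poly)"
        by (simp add: var_x_def var_t_def mult_single left_diff_distrib)
      then have "monom ?aw = monom ?w - var_x j * (monom ?aw :: ('n, 'k) free_poly)"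
        by (simp add: algebra_simps)
      then show ?thesis
        using Cons.IH[OF red] False
        by (simp add: a distrib_left sum.distrib add_diff_eq if_distrib[of "\<lambda>x. _ * x"]
            cong: if_cong)
    qed
  qed
  from this[of "word_of g"] show ?thesis
    using word_of[of g] by (simp add: word_of_inverse)
qed

lemma fox_decomp:
  "f = scalar (augmentation f) + (\<Sum>i\<in>UNIV. var_x i * fox i f)"
  for f :: "('n::finite, 'k::field) free_poly"
proof (induction f rule: poly_mapping_induct)
  case (single g c)
  have "Poly_Mapping.single g c = scalar c * monom g"
    by (simp add: scalar_mult_single)
  also have "\<dots> = scalar c * (1 + (\<Sum>i\<in>UNIV. var_x i * fox_word i (word_of g)))"
    by (subst monom_decomp) simp
  also have "\<dots> = scalar c + (\<Sum>i\<in>UNIV. scalar c * (var_x i * fox_word i (word_of g)))"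
    by (simp add: distrib_left sum_distrib_left)
  also have "\<dots> = scalar c + (\<Sum>i\<in>UNIV. var_x i * (scalar c * fox_word i (word_of g)))"
    by (metis (no_types, lifting) mult.assoc scalar_commute)
  finally show ?case unfolding fox_single augmentation_single .
next
  case (sum f g)
  have "scalar (augmentation (f + g)) + (\<Sum>i\<in>UNIV. var_x i * fox i (f + g))
      = (scalar (augmentation f) + (\<Sum>i\<in>UNIV. var_x i * fox i f))
        + (scalar (augmentation g) + (\<Sum>i\<in>UNIV. var_x i * fox i g))"
    by (simp add: augmentation_add scalar_add fox_add distrib_left sum.distrib)
  then show ?case unfolding sum[symmetric] by (rule sym)
qed

lemma fox_decomp_0:
  "augmentation f = 0 \<Longrightarrow> f = (\<Sum>i\<in>UNIV. var_x i * fox i f)"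
  for f :: "('n::finite, 'k::field) free_poly"
  using fox_decomp[of f] by simp

lemma ex_fox_ne_0: "augmentation f = 0 \<Longrightarrow> f \<noteq> 0 \<Longrightarrow> \<exists>i. fox i f \<noteq> 0"
  for f :: "('n::finite, 'k::field) free_poly"
  by (metis (no_types, lifting) fox_decomp_0 mult_zero_right sum.neutral)

text \<open>Only the left factor is expanded by \<open>fox_decomp\<close>; deriving then picks out
  the cofactor of \<open>var_x i\<close>.\<close>

lemma fox_mult:
  fixes f g :: "('n::finite, 'k::field) free_poly"
  shows "fox i (f * g) = scalar (augmentation f) * fox i g + fox i f * g"
proof -
  have sc: "fox i (scalar c * g) = scalar c * fox i g" for c
    by (induction g rule: poly_mapping_induct)
       (simp_all add: scalar_mult_single fox_single fox_add distrib_left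
         mult.assoc[symmetric] scalar_def mult_single)
  have "f * g = scalar (augmentation f) * g + (\<Sum>j\<in>UNIV. var_x j * (fox j f * g))"
    by (subst fox_decomp[of f]) (simp add: distrib_right sum_distrib_right mult.assoc)
  then show ?thesis
    by (simp add: fox_add sc fox_var_x_sum)
qed

lemma fox_scalar_mult: "fox i (scalar c * f) = scalar c * fox i f"
  for f :: "('n::finite, 'k::field) free_poly"
  by (simp add: fox_mult)

section \<open>Leading coefficients\<close>

definition begins :: "'n \<times> bool \<Rightarrow> 'n free_group \<Rightarrow> bool" where
  "begins a g \<longleftrightarrow> (\<exists>w. word_of g = a # w)"

text \<open>A strict bound that also makes sense for 0, whose \<open>poly_length\<close> is
  unspecified; \<open>shorter (Suc m)\<close> encodes length at most \<open>m\<close>.\<close>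

definition shorter :: "nat \<Rightarrow> ('n, 'k::field) free_poly \<Rightarrow> bool" where
  "shorter m f \<longleftrightarrow> (\<forall>g. m \<le> length (word_of g) \<longrightarrow> Poly_Mapping.lookup f g = 0)"

lemma shorterD: "shorter m f \<Longrightarrow> m \<le> length (word_of g) \<Longrightarrow> Poly_Mapping.lookup f g = 0"
  by (simp add: shorter_def)

lemma shorter_add: "shorter m f \<Longrightarrow> shorter m g \<Longrightarrow> shorter m (f + g)"
  by (simp add: shorter_def lookup_add)

lemma shorter_diff: "shorter m f \<Longrightarrow> shorter m g \<Longrightarrow> shorter m (f - g)"
  by (simp add: shorter_def lookup_minus)

lemma shorter_scalar_mult: "shorter m f \<Longrightarrow> shorter m (scalar c * f)"
  by (simp add: shorter_def lookup_scalar_mult)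

lemma shorter_mono: "shorter m f \<Longrightarrow> m \<le> m' \<Longrightarrow> shorter m' f"
  by (auto simp: shorter_def)

lemma shorter_0_iff: "shorter 0 f \<longleftrightarrow> f = 0"
  by (auto simp: shorter_def intro: poly_mapping_eqI)

lemma shorter_Suc_iff:
  assumes "f \<noteq> 0"
  shows "shorter (Suc m) f \<longleftrightarrow> poly_length f \<le> m"
proof -
  have "poly_length f \<le> m \<longleftrightarrow> (\<forall>g\<in>Poly_Mapping.keys f. length (word_of g) \<le> m)"
    using assms by (simp add: poly_length_def)
  then show ?thesis
    unfolding shorter_def by (metis in_keys_iff not_less_eq_eq)
qed

text \<open>Every word created by \<open>fox_word i w\<close> is a suffix of \<open>w\<close>, and
  only the first letter can contribute \<open>w\<close> itself.\<close>

lemma lookup_fox_word: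
  "length w \<le> length (word_of h) \<Longrightarrow> reduced w \<Longrightarrow>
     Poly_Mapping.lookup (fox_word i w) h =
       (if word_of h = w \<and> begins (i, False) h then - 1 else (0 :: 'k::field))"
proof (induction w)
  case (Cons a w)
  have red: "reduced w" using Cons.prems(2) by (rule reduced_tl)
  have wo: "word_of (Abs_free_group w) = w" "word_of (Abs_free_group (a # w)) = a # w"
    using red Cons.prems by (simp_all add: Abs_free_group_inverse)
  have lt: "length w < length (word_of h)" using Cons.prems(1) by simp
  have w: "Poly_Mapping.lookup (monom (Abs_free_group w) :: ('a, 'k) free_poly) h = 0"
    using wo(1) lt by (metis less_irrefl lookup_single_not_eq)
  have IH: "Poly_Mapping.lookup (fox_word i w) h = (0 :: 'k)"
    using Cons.IH red lt by (metis less_imp_le less_irrefl)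
  show ?case
  proof (cases "a = (i, False)")
    case True
    have "Poly_Mapping.lookup (monom (Abs_free_group (a # w)) :: ('a, 'k) free_poly) h
        = (if word_of h = a # w then 1 else 0)"
      using wo(2) by (metis lookup_single_eq lookup_single_not_eq word_of_inverse)
    moreover have "begins (i, False) h" if "word_of h = a # w"
      using that True by (simp add: begins_def)
    ultimately show ?thesis using IH True by (simp add: lookup_minus)
  next
    case False
    then have "\<not> (word_of h = a # w \<and> begins (i, False) h)"
      by (auto simp: begins_def)
    then show ?thesis using IH w False by (simp add: lookup_add)
  qed
qed (simp add: begins_def)

text \<open>A derivative only creates proper suffixes, apart from the words beginning with
  \<open>t\<^sub>i\<inverse>\<close>, which it retains with the opposite sign.\<close>

lemma lookup_fox:
  assumes "shorter (Suc m) f" "m \<le> length (word_of h)"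
  shows "Poly_Mapping.lookup (fox i f) h =
    (if begins (i, False) h then - Poly_Mapping.lookup f h else 0)"
proof -
  have "Poly_Mapping.lookup (fox i f) h = (\<Sum>g\<in>Poly_Mapping.keys f.
      Poly_Mapping.lookup f g * Poly_Mapping.lookup (fox_word i (word_of g)) h)"
    by (simp add: fox_def lookup_sum lookup_scalar_mult)
  also have "\<dots> = (\<Sum>g\<in>Poly_Mapping.keys f.
      if g = h then (if begins (i, False) h then - Poly_Mapping.lookup f h else 0) else 0)"
  proof (rule sum.cong[OF refl])
    fix g assume g: "g \<in> Poly_Mapping.keys f"
    have "length (word_of g) \<le> m"
      using assms(1) g by (meson in_keys_iff not_less_eq_eq shorterD)
    then have "length (word_of g) \<le> length (word_of h)" using assms(2) by simp
    moreover have "reduced (word_of g)" using word_of[of g] by simp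
    ultimately show "Poly_Mapping.lookup f g * Poly_Mapping.lookup (fox_word i (word_of g)) h =
        (if g = h then (if begins (i, False) h then - Poly_Mapping.lookup f h else 0) else 0)"
      by (simp add: lookup_fox_word word_of_inject)
  qed
  also have "\<dots> = (if begins (i, False) h then - Poly_Mapping.lookup f h else 0)"
    by (auto simp: in_keys_iff)
  finally show ?thesis .
qed

lemma shorter_fox: "shorter (Suc m) f \<Longrightarrow> shorter (Suc m) (fox i f)"
  unfolding shorter_def[of _ "fox i f"]
  by (auto simp: lookup_fox shorterD)

lemma begins_unique: "begins a g \<Longrightarrow> begins b g \<Longrightarrow> a = b"
  by (auto simp: begins_def)

text \<open>By \<open>lookup_fox\<close>, the words of length \<open>m\<close> in
  \<open>fox i f\<close> all begin with the inverse of \<open>gen i\<close>; a second derivative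
  negates or drops them.\<close>

lemma lookup_fox_fox:
  assumes "shorter (Suc m) f" "m \<le> length (word_of h)"
  shows "Poly_Mapping.lookup (fox j (fox i f)) h =
    (if i = j then - Poly_Mapping.lookup (fox i f) h else 0)"
  using lookup_fox[OF shorter_fox[OF assms(1)] assms(2)] lookup_fox[OF assms]
    begins_unique[of _ h] by auto

text \<open>Otherwise \<open>- gen i + h\<close> is one letter longer than \<open>h\<close>, hence
  too long to occur in \<open>f\<close>.\<close>

lemma begins_var_t_mult:
  assumes "shorter (Suc m) f" "m \<le> length (word_of h)"
    and "Poly_Mapping.lookup (var_t i * f) h \<noteq> 0"
  shows "begins (i, True) h"
proof (rule ccontr)
  assume nb: "\<not> begins (i, True) h"
  have "- gen i = Abs_free_group [(i, False)]"
    by (rule word_of_inject[THEN iffD1])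
       (simp add: uminus_free_group.rep_eq gen.rep_eq letter_inv_def Abs_free_group_inverse
         reduced_def)
  then have "word_of (- gen i + h) = cons_red (i, False) (word_of h)"
    by (simp add: plus_free_group.rep_eq Abs_free_group_inverse reduced_def)
  then have "length (word_of (- gen i + h)) = Suc (length (word_of h))"
    using nb by (cases "word_of h") (auto simp: begins_def letter_inv_def)
  then show False
    using assms by (simp add: var_t_def lookup_monom_mult shorterD)
qed

lemma var_t_cancel: "monom (- gen i) * (var_t i * f) = f"
  by (simp add: var_t_def mult.assoc[symmetric] mult_single)

section \<open>Left ideals closed under derivatives\<close>

text \<open>Three instances are used: the trace on \<Lambda> of a left ideal of the Fox algebra, the
  left multiples of a comonic element, and its left annihilator.\<close>

locale fox_ideal =
  fixes K :: "('n::finite, 'k::field) free_poly set"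
  assumes zero_closed: "0 \<in> K"
    and add_closed: "f \<in> K \<Longrightarrow> g \<in> K \<Longrightarrow> f + g \<in> K"
    and mult_closed: "f \<in> K \<Longrightarrow> r * f \<in> K"
    and fox_closed: "f \<in> K \<Longrightarrow> augmentation f = 0 \<Longrightarrow> fox i f \<in> K"
begin

lemma diff_closed: "f \<in> K \<Longrightarrow> g \<in> K \<Longrightarrow> f - g \<in> K"
  using add_closed[of f "- g"] mult_closed[of g "- 1"] by simp

lemma var_t_closed_iff: "var_t i * f \<in> K \<longleftrightarrow> f \<in> K"
  using mult_closed[of f "var_t i"] mult_closed[of "var_t i * f" "monom (- gen i)"]
  by (auto simp: var_t_cancel)

lemma sum_closed: "(\<And>x. x \<in> A \<Longrightarrow> f x \<in> K) \<Longrightarrow> (\<Sum>x\<in>A. f x) \<in> K"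
  by (induction A rule: infinite_finite_induct) (auto intro: zero_closed add_closed)

end

lemma var_t_eq: "var_t i = 1 + var_x i"
  by (simp add: var_x_def)

text \<open>If \<open>fox i p + f\<close> and the other \<open>fox j p\<close> are shorter than
  \<open>f\<close>, this controls \<open>var_t i * f\<close> up to \<open>f - p\<close>, and hence
  \<open>f\<close>, as \<open>var_t i\<close> is invertible.\<close>

lemma sum_split_var_x:
  fixes f p :: "('n::finite, 'k::field) free_poly"
  assumes "augmentation p = 0"
  shows "var_t i * f = f - p + var_x i * (fox i p + f) + (\<Sum>j\<in>UNIV - {i}. var_x j * fox j p)"
proof -
  have "p = (\<Sum>j\<in>UNIV. var_x j * fox j p)" using assms by (rule fox_decomp_0)
  also have "\<dots> = var_x i * fox i p + (\<Sum>j\<in>UNIV - {i}. var_x j * fox j p)"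
    by (rule sum.remove) simp_all
  finally have p: "p = \<dots>" .
  have "(1 + x) * f = f - q + x * (d + f) + S" if "q = x * d + S"
    for x q d S :: "('n, 'k) free_poly"
    using that by (simp add: algebra_simps)
  from this[OF p] show ?thesis unfolding var_t_eq .
qed

section \<open>Elements of minimal length\<close>

locale minimal_fox_ideal = fox_ideal K for K :: "('n::finite, 'k::field) free_poly set" +
  fixes m :: nat
  assumes minimal: "f \<in> K \<Longrightarrow> shorter m f \<Longrightarrow> f = 0"
    and ex_short: "\<exists>f\<in>K. f \<noteq> 0 \<and> shorter (Suc m) f"
begin

text \<open>Used in contrapositive form, to rescale a nonzero derivative to a comonic element. For
  \<open>?g\<close> of augmentation 0, the longest words cancel in \<open>fox i ?g + ?g\<close> and
  are absent from the other \<open>fox j ?g\<close>; minimality makes all of these 0.\<close>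

lemma fox_augmentation_ne_0:
  assumes "f \<in> K" "shorter (Suc m) f" "augmentation f = 0" "augmentation (fox i f) = 0"
  shows "fox i f = 0"
proof -
  let ?g = "fox i f"
  have g: "?g \<in> K" using assms fox_closed by blast
  have 1: "fox i ?g + ?g = 0"
    by (rule minimal) (use g assms fox_closed add_closed in
        \<open>auto simp: shorter_def lookup_add lookup_fox_fox[OF assms(2)]\<close>)
  have 2: "fox j ?g = 0" if "j \<noteq> i" for j
    by (rule minimal) (use g assms that fox_closed in
        \<open>auto simp: shorter_def lookup_fox_fox[OF assms(2)]\<close>)
  have "var_t i * ?g = 0"
    using sum_split_var_x[OF assms(4), of i ?g] 1 2 by simp
  then show ?thesis using var_t_cancel[of i ?g] by simp
qed

text \<open>If \<open>f\<^sub>i = \<partial>\<^sub>i f\<close> and \<open>f\<^sub>j = \<partial>\<^sub>j f\<close> are nonzero, then \<open>g = f\<^sub>i - c f\<^sub>j\<close> has augmentation 0 for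
  some \<open>c\<close>. Minimality forces \<open>\<partial>\<^sub>i g = - f\<^sub>i\<close> and \<open>\<partial>\<^sub>j g = c f\<^sub>j\<close>, whence \<open>t\<^sub>i f\<^sub>i = c t\<^sub>j f\<^sub>j\<close>, whose
  longest words begin both with \<open>t\<^sub>i\<close> and with \<open>t\<^sub>j\<close>.\<close>

lemma fox_single_direction:
  assumes f: "f \<in> K" "shorter (Suc m) f" "augmentation f = 0"
    and ne: "fox i f \<noteq> 0" "fox j f \<noteq> 0"
  shows "i = j"
proof (rule ccontr)
  assume ij: "i \<noteq> j"
  define c where "c = augmentation (fox i f) / augmentation (fox j f)"
  define g where "g = fox i f - scalar c * fox j f"
  have aj: "augmentation (fox j f) \<noteq> 0"
    using fox_augmentation_ne_0[OF f] ne by blast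
  have K: "fox l f \<in> K" for l using f fox_closed by blast
  have ag: "augmentation g = 0"
    using aj by (simp add: g_def augmentation_diff augmentation_mult c_def)
  have gK: "g \<in> K" by (auto simp: g_def intro: diff_closed mult_closed K)
  have lg: "Poly_Mapping.lookup (fox l g) h = (if l = i then - Poly_Mapping.lookup (fox i f) h
      else if l = j then c * Poly_Mapping.lookup (fox j f) h else 0)"
    if "m \<le> length (word_of h)" for l h
    using ij lookup_fox_fox[OF f(2) that]
    by (auto simp: g_def fox_diff fox_scalar_mult lookup_minus lookup_scalar_mult)
  have i: "fox i g + fox i f = 0"
    by (rule minimal) (use gK ag K in
        \<open>auto simp: shorter_def lookup_add lg intro: add_closed fox_closed\<close>)
  have j: "fox j g - scalar c * fox j f = 0"
    by (rule minimal) (use ij gK ag K in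
        \<open>auto simp: shorter_def lookup_minus lookup_scalar_mult lg
          intro: diff_closed mult_closed fox_closed\<close>)
  have l: "fox l g = 0" if "l \<noteq> i" "l \<noteq> j" for l
    by (rule minimal) (use that gK ag K in
        \<open>auto simp: shorter_def lg intro: fox_closed\<close>)
  have "(\<Sum>l\<in>UNIV - {i}. var_x l * fox l g) = (\<Sum>l\<in>{j}. var_x l * fox l g)"
    by (rule sum.mono_neutral_right) (use ij l in auto)
  then have "var_t i * fox i f = scalar c * fox j f + var_x j * (scalar c * fox j f)"
    using sum_split_var_x[OF ag, of i "fox i f"] i j by (simp add: g_def)
  also have "\<dots> = scalar c * (var_t j * fox j f)"
    by (metis (no_types) distrib_left distrib_right mult.assoc mult_1 scalar_commute var_t_eq)
  finally have eq: "var_t i * fox i f = scalar c * (var_t j * fox j f)" .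
  have "var_t i * fox i f \<noteq> 0"
    using var_t_cancel[of i "fox i f"] ne(1) by auto
  moreover have "var_t i * fox i f \<in> K" using K mult_closed by blast
  ultimately obtain h where h: "m \<le> length (word_of h)"
      "Poly_Mapping.lookup (var_t i * fox i f) h \<noteq> 0"
    by (metis minimal shorter_def)
  then have "begins (i, True) h"
    using begins_var_t_mult[OF shorter_fox[OF f(2)]] by blast
  moreover have "begins (j, True) h"
    using begins_var_t_mult[OF shorter_fox[OF f(2)] h(1)] h(2) unfolding eq lookup_scalar_mult
    by auto
  ultimately show False using ij begins_unique by blast
qed

lemma fox_decomp_single:
  assumes f: "f \<in> K" "shorter (Suc m) f" "augmentation f = 0" and ne: "fox i f \<noteq> 0"
  shows "f = var_x i * fox i f"
proof -
  have "f = (\<Sum>j\<in>UNIV. var_x j * fox j f)" using f(3) by (rule fox_decomp_0)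
  also have "\<dots> = (\<Sum>j\<in>{i}. var_x j * fox j f)"
  proof (rule sum.mono_neutral_right)
    show "\<forall>j\<in>UNIV - {i}. var_x j * fox j f = 0"
      using fox_single_direction[OF f ne] by (metis DiffE insertI1 mult_zero_right)
  qed simp_all
  finally show ?thesis
    by (simp only: sum.insert sum.empty finite.emptyI empty_iff not_False_eq_True add_0_right)
qed

text \<open>If some nonzero shortest element has augmentation 0, \<delta> is its rescaled nonzero
  derivative. Otherwise \<delta> is any rescaled shortest element, and subtracting a multiple of it
  to reach augmentation 0 leaves 0.\<close>

lemma ex_generator_short:
  "\<exists>\<delta>\<in>K. comonic \<delta> \<and> shorter (Suc m) \<delta> \<and> (\<forall>g\<in>K. shorter (Suc m) g \<longrightarrow> (\<exists>r. g = r * \<delta>))"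
proof (cases "\<exists>f\<in>K. shorter (Suc m) f \<and> augmentation f = 0 \<and> f \<noteq> 0")
  case True
  then obtain f where f: "f \<in> K" "shorter (Suc m) f" "augmentation f = 0" "f \<noteq> 0" by blast
  obtain i where i: "fox i f \<noteq> 0" using ex_fox_ne_0 f by blast
  define c where "c = augmentation (fox i f)"
  have c: "c \<noteq> 0" using fox_augmentation_ne_0 f i by (auto simp: c_def)
  define \<delta> where "\<delta> = scalar (1 / c) * fox i f"
  have fi: "fox i f = scalar c * \<delta>"
    using c by (simp add: \<delta>_def scalar_def mult.assoc[symmetric] mult_single)
  have \<delta>K: "\<delta> \<in> K" using f fox_closed mult_closed by (simp add: \<delta>_def)
  have \<delta>a: "augmentation \<delta> = 1" using c by (simp add: \<delta>_def augmentation_mult c_def[symmetric])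
  have \<delta>s: "shorter (Suc m) \<delta>" using f by (simp add: \<delta>_def shorter_scalar_mult shorter_fox)
  have "\<exists>r. g = r * \<delta>" if g: "g \<in> K" "shorter (Suc m) g" for g
  proof -
    define h where "h = g - scalar (augmentation g) * \<delta>"
    have h: "h \<in> K" "shorter (Suc m) h" "augmentation h = 0"
      using g \<delta>K \<delta>a \<delta>s
      by (auto simp: h_def augmentation_diff augmentation_mult
          intro: diff_closed mult_closed shorter_diff shorter_scalar_mult)
    have "\<exists>r. h = r * \<delta>"
    proof (cases "h = 0")
      case True
      then show ?thesis by (intro exI[of _ 0]) simp
    next
      case False
      then obtain j where j: "fox j h \<noteq> 0" using ex_fox_ne_0 h by blast
      \<comment> \<open>This \<open>d\<close> gives \<open>fox i (h + scalar d * f)\<close>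
        augmentation 0, so that it vanishes.\<close>
      define d where "d = - augmentation (fox i h) / c"
      define k where "k = h + scalar d * f"
      have k: "k \<in> K" "shorter (Suc m) k" "augmentation k = 0"
        using f h by (auto simp: k_def augmentation_add augmentation_mult
            intro: add_closed mult_closed shorter_add shorter_scalar_mult)
      have ki: "fox i k = fox i h + scalar d * fox i f"
        by (simp add: k_def fox_add fox_scalar_mult)
      have "fox i k = 0"
        by (rule fox_augmentation_ne_0)
           (use k c in \<open>auto simp: ki augmentation_add augmentation_mult c_def[symmetric] d_def\<close>)
      then have hi: "fox i h = scalar (- d) * fox i f"
        by (simp add: ki scalar_uminus eq_neg_iff_add_eq_0)
      \<comment> \<open>Otherwise \<open>f + h\<close> would have nonzero derivatives in two
        directions.\<close>
      have "j = i"
      proof (rule ccontr)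
        assume ji: "j \<noteq> i"
        have "fox i h = 0" using fox_single_direction[OF h j] ji by blast
        then have "fox i (f + h) \<noteq> 0" using i by (simp add: fox_add)
        moreover have "fox j f = 0" using fox_single_direction[OF f(1-3) i] ji by blast
        then have "fox j (f + h) \<noteq> 0" using j by (simp add: fox_add)
        moreover have "f + h \<in> K" "shorter (Suc m) (f + h)" "augmentation (f + h) = 0"
          using f h by (auto simp: augmentation_add intro: add_closed shorter_add)
        ultimately show False using fox_single_direction ji by blast
      qed
      then have "h = var_x i * fox i h" using fox_decomp_single[OF h] j by blast
      then show ?thesis using hi fi by (metis mult.assoc)
    qed
    then obtain r where "h = r * \<delta>" ..
    then have "g = (r + scalar (augmentation g)) * \<delta>"
      by (simp add: h_def algebra_simps)
    then show ?thesis ..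
  qed
  then show ?thesis using \<delta>K \<delta>a \<delta>s by (auto simp: comonic_def)
next
  case False
  obtain f where f: "f \<in> K" "f \<noteq> 0" "shorter (Suc m) f" using ex_short by blast
  have a: "augmentation f \<noteq> 0" using False f by blast
  define \<delta> where "\<delta> = scalar (1 / augmentation f) * f"
  have \<delta>: "\<delta> \<in> K" "shorter (Suc m) \<delta>" "augmentation \<delta> = 1"
    using f a by (auto simp: \<delta>_def augmentation_mult intro: mult_closed shorter_scalar_mult)
  have "g = scalar (augmentation g) * \<delta>" if g: "g \<in> K" "shorter (Suc m) g" for g
  proof -
    have "g - scalar (augmentation g) * \<delta> \<in> K"
      "shorter (Suc m) (g - scalar (augmentation g) * \<delta>)"
      "augmentation (g - scalar (augmentation g) * \<delta>) = 0"
      using g \<delta> by (auto simp: augmentation_diff augmentation_mult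
          intro: diff_closed mult_closed shorter_diff shorter_scalar_mult)
    then have "g - scalar (augmentation g) * \<delta> = 0" using False by blast
    then show ?thesis by simp
  qed
  then show ?thesis using \<delta> by (auto simp: comonic_def)
qed

end

text \<open>As \<delta> is comonic, \<open>r * \<delta>\<close> has the augmentation of
  \<open>r\<close>; when this is 0, the product rule leaves
  \<open>fox i r * \<delta>\<close>.\<close>

lemma fox_ideal_left_multiples:
  assumes "comonic \<delta>"
  shows "fox_ideal (range (\<lambda>r. r * \<delta>))"
proof
  show "0 \<in> range (\<lambda>r. r * \<delta>)" by (rule image_eqI[of _ _ 0]) simp_all
  show "f + g \<in> range (\<lambda>r. r * \<delta>)" if "f \<in> range (\<lambda>r. r * \<delta>)" "g \<in> range (\<lambda>r. r * \<delta>)" for f g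
    using that by (auto simp: distrib_right[symmetric])
  show "r * f \<in> range (\<lambda>r. r * \<delta>)" if "f \<in> range (\<lambda>r. r * \<delta>)" for f r
    using that by (auto simp: mult.assoc[symmetric])
  show "fox i f \<in> range (\<lambda>r. r * \<delta>)" if "f \<in> range (\<lambda>r. r * \<delta>)" "augmentation f = 0" for f i
    using that assms by (auto simp: fox_mult augmentation_mult comonic_def)
qed

context minimal_fox_ideal
begin

lemma ex_generator:
  "\<exists>\<delta>. comonic \<delta> \<and> shorter (Suc m) \<delta> \<and> K = range (\<lambda>r. r * \<delta>)"
proof -
  obtain \<delta> where \<delta>: "\<delta> \<in> K" "comonic \<delta>" "shorter (Suc m) \<delta>"
    and short: "\<And>g. g \<in> K \<Longrightarrow> shorter (Suc m) g \<Longrightarrow> \<exists>r. g = r * \<delta>"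
    using ex_generator_short by blast
  let ?D = "range (\<lambda>r. r * \<delta>)"
  interpret D: fox_ideal ?D using \<delta>(2) by (rule fox_ideal_left_multiples)
  have "\<delta> \<in> ?D" by (rule image_eqI[of _ _ 1]) simp_all
  have "f \<in> ?D" if "f \<in> K" "shorter (Suc M) f" "m \<le> M" for M f
    using that(3,1,2)
  proof (induction M arbitrary: f rule: dec_induct)
    case base
    then show ?case using short by blast
  next
    case (step M)
    have IH: "f \<in> ?D" if "f \<in> K" "shorter (Suc M) f" for f
      using step.IH that by blast
    \<comment> \<open>Corrects the augmentation to 0 modulo \<open>?D\<close>; since \<delta> is
      short, the leading coefficients of derivatives are unaffected.\<close>
    define p where "p g = g - scalar (augmentation g) * \<delta>" for g
    have p: "p g \<in> K" "augmentation (p g) = 0" "g - p g \<in> ?D" if "g \<in> K" for g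
      using that \<delta> by (auto simp: p_def augmentation_diff augmentation_mult comonic_def
          intro: diff_closed mult_closed)
    have p_lookup: "Poly_Mapping.lookup (fox j (p g)) h = Poly_Mapping.lookup (fox j g) h"
      if "Suc M \<le> length (word_of h)" for g h j
    proof -
      have "shorter (Suc M) \<delta>" using \<delta>(3) step.hyps shorter_mono by (metis Suc_le_mono)
      then have "Poly_Mapping.lookup (fox j \<delta>) h = 0"
        using that by (intro shorterD[OF shorter_fox])
      then show ?thesis
        by (simp add: p_def fox_diff fox_scalar_mult lookup_minus lookup_scalar_mult)
    qed
    have pf: "p f \<in> K" "augmentation (p f) = 0" using p step.prems by blast+
    have sp: "shorter (Suc (Suc M)) (p f)"
      unfolding p_def
      by (intro shorter_diff shorter_scalar_mult step.prems shorter_mono[OF \<delta>(3)])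
         (use step.hyps in simp)
    \<comment> \<open>A derivative may be as long as \<open>f\<close>, so the induction hypothesis
      is applied only after a second derivative has cancelled or removed the longest words.\<close>
    have "fox i (p f) \<in> ?D" for i
    proof -
      let ?f = "fox i (p f)"
      have fK: "?f \<in> K" using pf fox_closed by blast
      let ?p = "p ?f"
      have pK: "?p \<in> K" "augmentation ?p = 0" "?f - ?p \<in> ?D" using p fK by blast+
      have look: "Poly_Mapping.lookup (fox j ?p) h =
          (if i = j then - Poly_Mapping.lookup ?f h else 0)"
        if "Suc M \<le> length (word_of h)" for j h
        using p_lookup[OF that] lookup_fox_fox[OF sp that] by simp
      have "fox i ?p + ?f \<in> ?D"
        by (rule IH) (use pK fK in
            \<open>auto simp: shorter_def lookup_add look intro: add_closed fox_closed\<close>)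
      moreover
      have "fox j ?p \<in> ?D" if "j \<noteq> i" for j
        by (rule IH) (use pK that in \<open>auto simp: shorter_def look intro: fox_closed\<close>)
      then have "(\<Sum>j\<in>UNIV - {i}. var_x j * fox j ?p) \<in> ?D"
        by (intro D.sum_closed D.mult_closed) blast
      ultimately have "?f - ?p + var_x i * (fox i ?p + ?f)
          + (\<Sum>j\<in>UNIV - {i}. var_x j * fox j ?p) \<in> ?D"
        by (intro D.add_closed[OF D.add_closed[OF pK(3) D.mult_closed]])
      then have "var_t i * ?f \<in> ?D"
        by (simp only: sum_split_var_x[OF pK(2), of i ?f])
      then show ?thesis by (simp only: D.var_t_closed_iff)
    qed
    then have "p f \<in> ?D"
      by (subst fox_decomp_0[OF pf(2)]) (intro D.sum_closed D.mult_closed)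
    from D.add_closed[OF this p(3)[OF step.prems(1)]] show ?case by simp
  qed
  moreover have "\<exists>M\<ge>m. shorter (Suc M) f" for f :: "('n, 'k) free_poly"
  proof (cases "f = 0")
    case False
    then show ?thesis
      by (intro exI[of _ "max m (poly_length f)"]) (simp add: shorter_Suc_iff)
  qed (auto simp: shorter_def)
  ultimately have "K \<subseteq> ?D" by blast
  moreover have "?D \<subseteq> K" using \<delta>(1) mult_closed by blast
  ultimately show ?thesis using \<delta> by blast
qed

end

lemma (in fox_ideal) generator:
  assumes "f \<in> K" "f \<noteq> 0"
  shows "\<exists>\<delta>. comonic \<delta> \<and> K = range (\<lambda>r. r * \<delta>)
    \<and> (\<forall>g\<in>K. g \<noteq> 0 \<longrightarrow> poly_length \<delta> \<le> poly_length g)"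
proof -
  define P where "P m \<longleftrightarrow> (\<exists>g\<in>K. g \<noteq> 0 \<and> shorter (Suc m) g)" for m
  define m where "m = (LEAST m. P m)"
  have P: "P (poly_length g)" if "g \<in> K" "g \<noteq> 0" for g
    using that shorter_Suc_iff[of g "poly_length g"] by (auto simp: P_def)
  then have Pm: "P m" unfolding m_def using assms by (intro LeastI)
  interpret minimal_fox_ideal K m
  proof
    show "\<exists>f\<in>K. f \<noteq> 0 \<and> shorter (Suc m) f" using Pm by (simp add: P_def)
    fix g assume g: "g \<in> K" "shorter m g"
    show "g = 0"
    proof (cases m)
      case 0
      then show ?thesis using g by (simp add: shorter_0_iff)
    next
      case (Suc m')
      then have "\<not> P m'" unfolding m_def using not_less_Least[of m' P] by simp
      then show ?thesis using g Suc by (auto simp: P_def)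
    qed
  qed
  obtain \<delta> where \<delta>: "comonic \<delta>" "shorter (Suc m) \<delta>" "K = range (\<lambda>r. r * \<delta>)"
    using ex_generator by blast
  have "\<delta> \<noteq> 0" using \<delta>(1) by (auto simp: comonic_def)
  then have "poly_length \<delta> \<le> m" using \<delta>(2) shorter_Suc_iff by blast
  moreover have "m \<le> poly_length g" if "g \<in> K" "g \<noteq> 0" for g
    unfolding m_def by (rule Least_le) (rule P[OF that])
  ultimately show ?thesis using \<delta> order_trans by blast
qed

text \<open>The left annihilator of \<delta> consists of elements of augmentation 0 and is closed
  under derivatives; were it nonzero, \<open>generator\<close> would put a comonic element into
  it.\<close>

lemma comonic_mult_eq_0:
  fixes f \<delta> :: "('n::finite, 'k::field) free_poly"
  assumes "comonic \<delta>" "f * \<delta> = 0"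
  shows "f = 0"
proof (rule ccontr)
  assume "f \<noteq> 0"
  have aug: "augmentation g = 0" if "g * \<delta> = 0" for g
    using augmentation_mult[of g \<delta>] that assms(1) by (simp add: comonic_def)
  have "fox_ideal {g. g * \<delta> = 0}"
  proof
    show "fox i g \<in> {g. g * \<delta> = 0}" if "g \<in> {g. g * \<delta> = 0}" for i g
      using that fox_mult[of i g \<delta>] aug[of g] by simp
  qed (auto simp: distrib_right mult.assoc)
  from fox_ideal.generator[OF this, of f] assms(2) \<open>f \<noteq> 0\<close>
  obtain \<epsilon> where \<epsilon>: "comonic \<epsilon>" "{g. g * \<delta> = 0} = range (\<lambda>r. r * \<epsilon>)"
    by auto
  have "1 * \<epsilon> \<in> range (\<lambda>r. r * \<epsilon>)" by (rule rangeI)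
  then have "\<epsilon> * \<delta> = 0" unfolding \<epsilon>(2)[symmetric] by simp
  then show False using aug[of \<epsilon>] \<epsilon>(1) by (simp add: comonic_def)
qed

section \<open>The Fox module of a comonic polynomial\<close>

text \<open>For comonic \<open>\<delta>\<close> the map \<open>(m\<^sub>i) \<mapsto> \<Sum>\<^sub>i x\<^sub>i m\<^sub>i\<close> is bijective on \<open>\<Lambda>/\<Lambda>\<delta>\<close>, which makes
  this quotient a module over the Fox algebra. The action is given on representatives.\<close>

primrec act :: "('n, 'k::field) free_poly \<Rightarrow> ('n, 'k) fox_term \<Rightarrow>
    ('n, 'k) free_poly \<Rightarrow> ('n, 'k) free_poly" where
  "act \<delta> (Emb g) f = g * f"
| "act \<delta> (Star i) f = fox i (f - scalar (augmentation f) * \<delta>)"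
| "act \<delta> (Add a b) f = act \<delta> a f + act \<delta> b f"
| "act \<delta> (Neg a) f = - act \<delta> a f"
| "act \<delta> (Mul a b) f = act \<delta> a (act \<delta> b f)"

lemma act_diff: "act \<delta> a (f - g) = act \<delta> a f - act \<delta> a g"
  by (induction a arbitrary: f g)
     (simp_all add: augmentation_diff fox_diff scalar_diff left_diff_distrib right_diff_distrib
       add_diff_add)

text \<open>Makes the action descend to the quotient by the left multiples of \<delta>.\<close>

lemma act_left_multiple:
  fixes \<delta> :: "('n::finite, 'k::field) free_poly"
  assumes "comonic \<delta>" "f \<in> range (\<lambda>r. r * \<delta>)"
  shows "act \<delta> a f \<in> range (\<lambda>r. r * \<delta>)"
  using assms(2)
proof (induction a arbitrary: f)
  interpret fox_ideal "range (\<lambda>r. r * \<delta>)" using assms(1) by (rule fox_ideal_left_multiples)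
  {
    case (Emb g)
    then show ?case by (simp add: mult_closed)
  next
    case (Star i)
    then have "f - scalar (augmentation f) * \<delta> \<in> range (\<lambda>r. r * \<delta>)"
      by (intro diff_closed) auto
    then show ?case using assms(1)
      by (simp add: fox_closed augmentation_diff augmentation_mult comonic_def)
  next
    case (Neg a)
    from diff_closed[OF zero_closed Neg.IH[OF Neg.prems]] show ?case by simp
  next
    case (Add a b)
    then show ?case by (simp add: add_closed)
  next
    case (Mul a b)
    then show ?case by simp
  }
qed

lemma act_fox_cong:
  fixes \<delta> :: "('n::finite, 'k::field) free_poly"
  assumes \<delta>: "comonic \<delta>" and "fox_cong a b"
  shows "act \<delta> a f - act \<delta> b f \<in> range (\<lambda>r. r * \<delta>)"
  using assms(2)
proof (induction arbitrary: f)
  interpret fox_ideal "range (\<lambda>r. r * \<delta>)" using \<delta> by (rule fox_ideal_left_multiples)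
  {
    case (fc_sym a b)
    from diff_closed[OF zero_closed fc_sym.IH[of f]] show ?case by simp
  next
    case (fc_trans a b c)
    from add_closed[OF fc_trans.IH(1)[of f] fc_trans.IH(2)[of f]] show ?case by simp
  next
    case (fc_Add a a' b b')
    from add_closed[OF fc_Add.IH(1)[of f] fc_Add.IH(2)[of f]]
    show ?case by (simp add: add_diff_add)
  next
    case (fc_Neg a a')
    from diff_closed[OF zero_closed fc_Neg.IH[of f]] show ?case by simp
  next
    case (fc_Mul a a' b b')
    \<comment> \<open>The factors are exchanged one at a time, through
      \<open>act \<delta> a' (act \<delta> b f)\<close>.\<close>
    from add_closed[OF fc_Mul.IH(1)[of "act \<delta> b f"]
      act_left_multiple[OF \<delta> fc_Mul.IH(2)[of f], of a']]
    show ?case by (simp add: act_diff)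
  next
    case (fc_distrib_left a b c)
    have "act \<delta> a (x + y) = act \<delta> a x + act \<delta> a y" for x y
      using act_diff[of \<delta> a "x + y" y] by (simp add: algebra_simps)
    then show ?case using zero_closed by simp
  next
    case (fc_scalar c i)
    have "scalar c * (scalar d * \<delta>) = scalar (c * d) * \<delta>" for d
      by (simp add: scalar_def mult.assoc[symmetric] mult_single)
    then show ?case using zero_closed
      by (simp add: fox_scalar_mult[symmetric] augmentation_mult right_diff_distrib)
  next
    case (fc_star_x i j)
    then show ?case using zero_closed
      by (simp add: augmentation_mult fox_var_x_mult)
  next
    case (fc_x_star ns)
    let ?p = "f - scalar (augmentation f) * \<delta>"
    have "act \<delta> (foldr (\<lambda>i a. Add (Mul (Emb (var_x i)) (Star i)) a) ms (Emb 0)) f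
        = sum_list (map (\<lambda>i. var_x i * fox i ?p) ms)" for ms
      by (induction ms) simp_all
    then have "act \<delta> (foldr (\<lambda>i a. Add (Mul (Emb (var_x i)) (Star i)) a) ns (Emb 0)) f
        = (\<Sum>i\<in>UNIV. var_x i * fox i ?p)"
      using fc_x_star by (simp add: sum_list_distinct_conv_sum_set)
    \<comment> \<open>The outcome is \<open>?p\<close>, which agrees with \<open>f\<close> only
      modulo left multiples of \<delta>.\<close>
    also have "\<dots> = ?p"
      using \<delta> by (intro fox_decomp_0[symmetric])
        (simp add: augmentation_diff augmentation_mult comonic_def)
    finally have "act \<delta> (foldr (\<lambda>i a. Add (Mul (Emb (var_x i)) (Star i)) a) ns (Emb 0)) f = ?p" .
    with diff_closed[OF zero_closed, of "scalar (augmentation f) * \<delta>"] show ?case by simp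
  }
\<comment> \<open>The remaining relations hold exactly on representatives: the difference is the
  multiple by 0.\<close>
qed (auto simp: algebra_simps intro!: image_eqI[of _ _ 0])

text \<open>Applying both sides of \<open>emb f = r * emb \<delta>\<close> to the class of 1 gives
  \<open>f\<close> on the left and 0 on the right, since \<delta> annihilates that class.\<close>

lemma emb_left_multiple_iff:
  fixes f \<delta> :: "('n::finite, 'k::field) free_poly"
  assumes "comonic \<delta>"
  shows "emb f \<in> left_ideal1 (emb \<delta>) \<longleftrightarrow> f \<in> range (\<lambda>r. r * \<delta>)"
proof
  assume "emb f \<in> left_ideal1 (emb \<delta>)"
  then obtain r where "emb f = r * emb \<delta>" by (auto simp: left_ideal1_def)
  moreover obtain a where "r = abs_fox_algebra a"
    by (metis Quotient3_abs_rep Quotient3_fox_algebra)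
  ultimately have "fox_cong (Emb f) (Mul a (Emb \<delta>))"
    by (simp add: emb_def times_fox_algebra.abs_eq fox_algebra.abs_eq_iff)
  from act_fox_cong[OF assms this, of 1] have "f - act \<delta> a \<delta> \<in> range (\<lambda>r. r * \<delta>)"
    by simp
  moreover have "act \<delta> a \<delta> \<in> range (\<lambda>r. r * \<delta>)"
    by (rule act_left_multiple[OF assms]) (auto intro: image_eqI[of _ _ 1])
  ultimately have "f - act \<delta> a \<delta> + act \<delta> a \<delta> \<in> range (\<lambda>r. r * \<delta>)"
    by (rule fox_ideal.add_closed[OF fox_ideal_left_multiples[OF assms]])
  then show "f \<in> range (\<lambda>r. r * \<delta>)" by simp
qed (auto simp: left_ideal1_def emb_mult)

section \<open>Left ideals of the Fox algebra and their traces on \<Lambda>\<close>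

lemma emb_fox:
  fixes f :: "('n::finite, 'k::field) free_poly"
  assumes "augmentation f = 0"
  shows "emb (fox i f) = star i * emb f"
proof -
  have emb_sum: "emb (\<Sum>j\<in>A. g j) = (\<Sum>j\<in>A. emb (g j) :: ('n, 'k) fox_algebra)"
    for A :: "'n set" and g
    by (induction A rule: infinite_finite_induct) (simp_all add: emb_0 emb_add)
  have "star i * emb f = (\<Sum>j\<in>UNIV. (star i * emb (var_x j)) * emb (fox j f))"
    by (subst fox_decomp_0[OF assms]) (simp add: emb_sum emb_mult sum_distrib_left mult.assoc)
  also have "\<dots> = (\<Sum>j\<in>UNIV. if i = j then emb (fox j f) else 0)"
    by (rule sum.cong) (simp_all add: star_x)
  finally show ?thesis by simp
qed

text \<open>Closure under derivatives is closure under left multiplication by \<open>star i\<close>,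
  by \<open>emb_fox\<close>.\<close>

lemma fox_ideal_left_ideal2:
  "fox_ideal {f :: ('n::finite, 'k::field) free_poly. emb f \<in> left_ideal2 a b}"
proof -
  have add: "x + y \<in> left_ideal2 a b" if xy: "x \<in> left_ideal2 a b" "y \<in> left_ideal2 a b" for x y
  proof -
    obtain r s r' s' where "x = r * a + s * b" "y = r' * a + s' * b"
      using xy by (auto simp: left_ideal2_def)
    then have "x + y = (r + r') * a + (s + s') * b" by (simp add: algebra_simps)
    then show ?thesis by (auto simp: left_ideal2_def)
  qed
  have mult: "c * x \<in> left_ideal2 a b" if x: "x \<in> left_ideal2 a b" for c x
  proof -
    obtain r s where "x = r * a + s * b" using x by (auto simp: left_ideal2_def)
    then have "c * x = (c * r) * a + (c * s) * b" by (simp add: algebra_simps)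
    then show ?thesis by (auto simp: left_ideal2_def)
  qed
  have "0 * a + 0 * b \<in> left_ideal2 a b" unfolding left_ideal2_def by blast
  then have "0 \<in> left_ideal2 a b" by simp
  then show ?thesis
    by unfold_locales (auto simp: emb_0 emb_add emb_mult emb_fox add mult)
qed

text \<open>The length bound is split into cases because \<open>poly_length\<close> is unspecified
  at 0.\<close>

theorem theorem7p19:
  fixes \<gamma> \<mu> :: "('n::finite, 'k::field) free_poly"
  assumes "CARD('n) \<ge> 2"
    and "\<gamma> \<noteq> 0 \<or> \<mu> \<noteq> 0"
  shows "\<exists>\<delta>. comonic \<delta>
      \<and> poly_length \<delta> \<le>
          (if \<gamma> = 0 then poly_length \<mu>
           else if \<mu> = 0 then poly_length \<gamma>
           else min (poly_length \<gamma>) (poly_length \<mu>))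
      \<and> left_ideal2 (emb \<gamma>) (emb \<mu>) = left_ideal1 (emb \<delta>)
      \<and> (\<forall>\<delta>'. comonic \<delta>' \<and> left_ideal2 (emb \<gamma>) (emb \<mu>) = left_ideal1 (emb \<delta>')
            \<longrightarrow> (\<exists>u. ring_unit u \<and> \<delta>' = u * \<delta>))"
proof -
  let ?J = "left_ideal2 (emb \<gamma>) (emb \<mu>) :: ('n, 'k) fox_algebra set"
  let ?K = "{f. emb f \<in> ?J}"
  interpret fox_ideal ?K by (rule fox_ideal_left_ideal2)
  have "1 * emb \<gamma> + 0 * emb \<mu> \<in> ?J" "0 * emb \<gamma> + 1 * emb \<mu> \<in> ?J"
    unfolding left_ideal2_def by blast+
  then have K: "\<gamma> \<in> ?K" "\<mu> \<in> ?K" by simp_all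
  then obtain f where "f \<in> ?K" "f \<noteq> 0" using assms(2) by blast
  from generator[OF this] obtain \<delta> where \<delta>: "comonic \<delta>" "?K = range (\<lambda>r. r * \<delta>)"
    and len: "\<forall>g\<in>?K. g \<noteq> 0 \<longrightarrow> poly_length \<delta> \<le> poly_length g"
    by (elim exE conjE)
  have "emb \<delta> \<in> ?J" using rangeI[of "\<lambda>r. r * \<delta>" 1] unfolding \<delta>(2)[symmetric] by simp
  then obtain r s where rs: "emb \<delta> = r * emb \<gamma> + s * emb \<mu>" by (auto simp: left_ideal2_def)
  obtain a b where ab: "\<gamma> = a * \<delta>" "\<mu> = b * \<delta>" using K unfolding \<delta>(2) by auto
  have J: "?J = left_ideal1 (emb \<delta>)"
  proof
    have "p * emb \<gamma> + q * emb \<mu> = (p * emb a + q * emb b) * emb \<delta>" for p q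
      by (simp add: ab emb_mult distrib_right mult.assoc)
    then show "?J \<subseteq> left_ideal1 (emb \<delta>)" by (auto simp: left_ideal1_def left_ideal2_def)
    have "p * emb \<delta> = (p * r) * emb \<gamma> + (p * s) * emb \<mu>" for p
      by (simp add: rs distrib_left mult.assoc)
    then show "left_ideal1 (emb \<delta>) \<subseteq> ?J" by (auto simp: left_ideal1_def left_ideal2_def)
  qed
  have "\<exists>u. ring_unit u \<and> \<delta>' = u * \<delta>" if "comonic \<delta>'" "?J = left_ideal1 (emb \<delta>')" for \<delta>'
  proof -
    \<comment> \<open>Contracting to \<Lambda> yields a unit \<open>u\<close> already among the free
      polynomials.\<close>
    have "?K = range (\<lambda>r. r * \<delta>')"
      using emb_left_multiple_iff[OF that(1)] that(2) by auto
    then have eq: "range (\<lambda>r. r * \<delta>) = range (\<lambda>r. r * \<delta>')" using \<delta>(2) by simp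
    obtain u where u: "\<delta>' = u * \<delta>"
      using rangeI[of "\<lambda>r. r * \<delta>'" 1] unfolding eq[symmetric] by auto
    obtain v where v: "\<delta> = v * \<delta>'"
      using rangeI[of "\<lambda>r. r * \<delta>" 1] unfolding eq by auto
    have "(u * v - 1) * \<delta>' = 0" using u v by (simp add: left_diff_distrib mult.assoc)
    from comonic_mult_eq_0[OF that(1) this] have "u * v = 1" by simp
    moreover have "(v * u - 1) * \<delta> = 0" using u v by (simp add: left_diff_distrib mult.assoc)
    from comonic_mult_eq_0[OF \<delta>(1) this] have "v * u = 1" by simp
    ultimately show ?thesis unfolding ring_unit_def using u by blast
  qed
  moreover have "poly_length \<delta> \<le> (if \<gamma> = 0 then poly_length \<mu>
      else if \<mu> = 0 then poly_length \<gamma> else min (poly_length \<gamma>) (poly_length \<mu>))"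
    using len K assms(2) by auto
  ultimately show ?thesis using \<delta>(1) J by blast
qed

end
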